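(* Let $A\subseteq E$ be associative conformal algebras ($A$ a subalgebra of $E$), and let $Q$ be a complement of $A$ in $E$, with associated matched pair of associative conformal algebras $(A,Q,\lhd_\lambda,\rhd_\lambda,\leftharpoonup_\lambda,\rightharpoonup_\lambda)$. Then an associative conformal algebra $\overline{Q}$ is a complement of $A$ in $E$ if and only if there exists a deformation map $\varphi:Q\to A$ of $(A,Q,\lhd_\lambda,\rhd_\lambda,\leftharpoonup_\lambda,\rightharpoonup_\lambda)$ such that $\overline{Q}\cong Q_\varphi$ (isomorphism of associative conformal algebras).
   Context: All vector spaces are over $\mathbb{C}$, and for a vector space $V$, $V[\lambda]$ denotes the space of polynomials in $\lambda$ with coefficients in $V$. An associative conformal algebra is a $\mathbb{C}[\partial]$-module $A$ with a $\mathbb{C}$-bilinear map $A\times A\to A[\lambda]$, $(a,b)\mapsto a_\lambda b$, satisfying $(\partial a)_\lambda b=-\lambda a_\lambda b$, $a_\lambda(\partial b)=(\partial+\lambda)a_\lambda b$ and $(a_\lambda b)_{\lambda+\mu}c=a_\lambda(b_\mu c)$ for all $a,b,c\in A$. $\mathbb{C}[\partial]$-module maps are extended coefficientwise to polynomials in $\lambda$. Homomorphisms are $\mathbb{C}[\partial]$-module maps preserving $\lambda$-products. A complement of a subalgebra $A$ in $E$ is a subalgebra $Q$ of $E$ such that $E=A\oplus Q$ as $\mathbb{C}[\partial]$-modules. Elements of $E=A\oplus Q$ are written $a\oplus x$ with $a\in A$, $x\in Q$. The associated matched pair $(A,Q,\lhd_\lambda,\rhd_\lambda,\leftharpoonup_\lambda,\rightharpoonup_\lambda)$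 consists of the operations $\rhd_\lambda:Q\times A\to A[\lambda]$, $\lhd_\lambda:Q\times A\to Q[\lambda]$, $\leftharpoonup_\lambda:A\times Q\to A[\lambda]$, $\rightharpoonup_\lambda:A\times Q\to Q[\lambda]$ determined by $x_\lambda a=(x\rhd_\lambda a)\oplus(x\lhd_\lambda a)$ and $a_\lambda x=(a\leftharpoonup_\lambda x)\oplus(a\rightharpoonup_\lambda x)$ for $a\in A$, $x\in Q$. The $\lambda$-product of $E$ is then that of the bicrossed product of $A$ and $Q$: $$(a\oplus x)_\lambda(b\oplus y)=(a_\lambda b+a\leftharpoonup_\lambda y+x\rhd_\lambda b)\oplus(a\rightharpoonup_\lambda y+x\lhd_\lambda b+x_\lambda y).$$ A deformation map of the matched pair is a $\mathbb{C}[\partial]$-module homomorphism $\varphi:Q\to A$ such that for all $x,y\in Q$ $$\varphi(x_\lambda y)-\varphi(x)_\lambda\varphi(y)=\varphi(x)\leftharpoonup_\lambda y+x\rhd_\lambda\varphi(y)-\varphi(\varphi(x)\rightharpoonup_\lambda y)-\varphi(x\lhd_\lambda\varphi(y)).$$ For a deformation map $\varphi$, the $\varphi$-deformation $Q_\varphi$ of $Q$ is the $\mathbb{C}[\partial]$-module $Q$ with the $\lambda$-product $(x_\lambda y)_\varphi:=x_\lambda y+x\lhd_\lambda\varphi(y)+\varphi(x)\rightharpoonup_\lambda y$, which is an associative conformal algebra.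
   Formalization: "Q̄ is a complement of A in E" is read up to isomorphism: Q̄ is isomorphic to a subalgebra Q' of E with E = A ⊕ Q'. Read literally, the "if" direction fails: with zero products and A ≅ Q ≠ 0, the algebra A is isomorphic to Q_φ for φ = 0 but is not a complement. *)

theory Defs
  imports Complex_Main "HOL-Computational_Algebra.Polynomial"
begin

text \<open>
  For a complex vector space \<open>V\<close>, an element of \<open>V[\<lambda>]\<close> is a value of type \<open>'a poly\<close> with coefficients
  in \<open>V\<close>, so that \<open>pCons 0\<close> is multiplication by \<open>\<lambda>\<close> and \<open>map_poly f\<close> is the coefficientwise
  extension of an additive map \<open>f\<close>.
\<close>

definition polys_over :: "'a::zero set \<Rightarrow> 'a poly set" where
  "polys_over S = {p. \<forall>n. coeff p n \<in> S}"

text \<open>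
  \<open>act E\<close> is the action of \<open>\<complex>[\<partial>]\<close>, realised as \<open>complex poly\<close>: a scalar \<open>c\<close> acts as \<open>[:c:]\<close> and
  \<open>\<partial>\<close> as \<open>[:0, 1:]\<close>. Addition is that of the type; the underlying module may be any submodule
  \<open>carrier E\<close>, so that a subalgebra of \<open>E\<close> is again such a structure. Values of \<open>lprod E\<close> outside the
  carrier are irrelevant.
\<close>

record (overloaded) ('a::zero) conf_alg =
  carrier :: "'a set"
  act :: "complex poly \<Rightarrow> 'a \<Rightarrow> 'a"
  lprod :: "'a \<Rightarrow> 'a \<Rightarrow> 'a poly"

definition cscale :: "'a::zero conf_alg \<Rightarrow> complex \<Rightarrow> 'a \<Rightarrow> 'a" where
  "cscale E c = act E [:c:]"

definition deriv_op :: "'a::zero conf_alg \<Rightarrow> 'a \<Rightarrow> 'a" where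
  "deriv_op E = act E [:0, 1:]"

text \<open>
  \<open>V[\<lambda>,\<mu>]\<close> is represented by \<open>'a poly poly\<close>, with \<open>\<mu>\<close> the outer and \<open>\<lambda>\<close> the inner variable.
\<close>

definition mult_lam :: "'a::ab_group_add poly poly \<Rightarrow> 'a poly poly" where
  "mult_lam = map_poly (pCons 0)"

definition mult_mu :: "'a::ab_group_add poly poly \<Rightarrow> 'a poly poly" where
  "mult_mu = pCons 0"

text \<open>\<open>p(\<lambda> + \<mu>)\<close> for \<open>p \<in> V[\<lambda>]\<close>\<close>

definition subst_lam_plus_mu :: "'a::ab_group_add poly \<Rightarrow> 'a poly poly" where
  "subst_lam_plus_mu p =
     (\<Sum>k\<le>degree p. ((\<lambda>q. mult_lam q + mult_mu q) ^^ k) [:[:coeff p k:]:])"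

text \<open>
  If \<open>a\<^sub>\<lambda> b = \<Sum>\<^sub>m \<lambda>\<^sup>m q\<^sub>m\<close> then \<open>(a\<^sub>\<lambda> b)\<^bsub>\<lambda>+\<mu>\<^esub> c\<close> is \<open>\<Sum>\<^sub>m \<lambda>\<^sup>m ((q\<^sub>m)\<^bsub>\<lambda>+\<mu>\<^esub> c)\<close>;
  if \<open>b\<^sub>\<mu> c = \<Sum>\<^sub>n \<mu>\<^sup>n r\<^sub>n\<close> then \<open>a\<^sub>\<lambda> (b\<^sub>\<mu> c)\<close> is \<open>\<Sum>\<^sub>n \<mu>\<^sup>n (a\<^sub>\<lambda> r\<^sub>n)\<close>.
\<close>

definition assoc_left :: "'a::ab_group_add conf_alg \<Rightarrow> 'a \<Rightarrow> 'a \<Rightarrow> 'a \<Rightarrow> 'a poly poly" where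
  "assoc_left E a b c =
     (\<Sum>m\<le>degree (lprod E a b).
        (mult_lam ^^ m) (subst_lam_plus_mu (lprod E (coeff (lprod E a b) m) c)))"

definition assoc_right :: "'a::ab_group_add conf_alg \<Rightarrow> 'a \<Rightarrow> 'a \<Rightarrow> 'a \<Rightarrow> 'a poly poly" where
  "assoc_right E a b c = map_poly (lprod E a) (lprod E b c)"

locale assoc_conf_alg = module "act E" for E :: "'a::ab_group_add conf_alg" +
  assumes carrier_submodule: "subspace (carrier E)"
    and lprod_closed: "\<lbrakk>a \<in> carrier E; b \<in> carrier E\<rbrakk> \<Longrightarrow> lprod E a b \<in> polys_over (carrier E)"
    and lprod_add_left: "\<lbrakk>a \<in> carrier E; a' \<in> carrier E; b \<in> carrier E\<rbrakk> \<Longrightarrow>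
      lprod E (a + a') b = lprod E a b + lprod E a' b"
    and lprod_add_right: "\<lbrakk>a \<in> carrier E; b \<in> carrier E; b' \<in> carrier E\<rbrakk> \<Longrightarrow>
      lprod E a (b + b') = lprod E a b + lprod E a b'"
    and lprod_cscale_left: "\<lbrakk>a \<in> carrier E; b \<in> carrier E\<rbrakk> \<Longrightarrow>
      lprod E (cscale E z a) b = map_poly (cscale E z) (lprod E a b)"
    and lprod_cscale_right: "\<lbrakk>a \<in> carrier E; b \<in> carrier E\<rbrakk> \<Longrightarrow>
      lprod E a (cscale E z b) = map_poly (cscale E z) (lprod E a b)"
    and lprod_deriv_left: "\<lbrakk>a \<in> carrier E; b \<in> carrier E\<rbrakk> \<Longrightarrow>
      lprod E (deriv_op E a) b = - pCons 0 (lprod E a b)"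
    and lprod_deriv_right: "\<lbrakk>a \<in> carrier E; b \<in> carrier E\<rbrakk> \<Longrightarrow>
      lprod E a (deriv_op E b) = map_poly (deriv_op E) (lprod E a b) + pCons 0 (lprod E a b)"
    and lprod_assoc: "\<lbrakk>a \<in> carrier E; b \<in> carrier E; c \<in> carrier E\<rbrakk> \<Longrightarrow>
      assoc_left E a b c = assoc_right E a b c"

definition subalgebra :: "'a::ab_group_add set \<Rightarrow> 'a conf_alg \<Rightarrow> bool" where
  "subalgebra A E \<longleftrightarrow> A \<subseteq> carrier E \<and> module.subspace (act E) A \<and>
     (\<forall>a\<in>A. \<forall>b\<in>A. lprod E a b \<in> polys_over A)"

definition restrict_to :: "'a::zero conf_alg \<Rightarrow> 'a set \<Rightarrow> 'a conf_alg" where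
  "restrict_to E S = E\<lparr>carrier := S\<rparr>"

definition complement :: "'a::ab_group_add set \<Rightarrow> 'a set \<Rightarrow> 'a conf_alg \<Rightarrow> bool" where
  "complement Q A E \<longleftrightarrow> subalgebra Q E \<and>
     A \<inter> Q = {0} \<and> carrier E = {a + x | a x. a \<in> A \<and> x \<in> Q}"

definition cmodule_hom :: "'a::ab_group_add conf_alg \<Rightarrow> 'b::ab_group_add conf_alg \<Rightarrow> ('a \<Rightarrow> 'b) \<Rightarrow> bool" where
  "cmodule_hom B C f \<longleftrightarrow>
     (\<forall>x\<in>carrier B. f x \<in> carrier C) \<and>
     (\<forall>x\<in>carrier B. \<forall>y\<in>carrier B. f (x + y) = f x + f y) \<and>
     (\<forall>p. \<forall>x\<in>carrier B. f (act B p x) = act C p (f x))"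

definition conf_hom :: "'a::ab_group_add conf_alg \<Rightarrow> 'b::ab_group_add conf_alg \<Rightarrow> ('a \<Rightarrow> 'b) \<Rightarrow> bool" where
  "conf_hom B C f \<longleftrightarrow> cmodule_hom B C f \<and>
     (\<forall>x\<in>carrier B. \<forall>y\<in>carrier B. map_poly f (lprod B x y) = lprod C (f x) (f y))"

definition conf_isomorphic :: "'a::ab_group_add conf_alg \<Rightarrow> 'b::ab_group_add conf_alg \<Rightarrow> bool" where
  "conf_isomorphic B C \<longleftrightarrow> (\<exists>f. conf_hom B C f \<and> bij_betw f (carrier B) (carrier C))"

text \<open>
  The four operations of a matched pair are passed in the order \<open>\<lhd>\<close>, \<open>\<rhd>\<close>, \<open>\<leftharpoonup>\<close>, \<open>\<rightharpoonup>\<close>.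
  On \<open>A\<close> and \<open>Q\<close> they are uniquely determined by the following condition when \<open>Q\<close> is a complement
  of \<open>A\<close>.
\<close>

definition associated_matched_pair ::
  "'a::ab_group_add conf_alg \<Rightarrow> 'a set \<Rightarrow> 'a set \<Rightarrow>
   ('a \<Rightarrow> 'a \<Rightarrow> 'a poly) \<Rightarrow> ('a \<Rightarrow> 'a \<Rightarrow> 'a poly) \<Rightarrow>
   ('a \<Rightarrow> 'a \<Rightarrow> 'a poly) \<Rightarrow> ('a \<Rightarrow> 'a \<Rightarrow> 'a poly) \<Rightarrow> bool" where
  "associated_matched_pair E A Q lhd rhd lharp rharp \<longleftrightarrow>
     (\<forall>x\<in>Q. \<forall>a\<in>A.
        rhd x a \<in> polys_over A \<and> lhd x a \<in> polys_over Q \<and> lprod E x a = rhd x a + lhd x a \<and>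
        lharp a x \<in> polys_over A \<and> rharp a x \<in> polys_over Q \<and> lprod E a x = lharp a x + rharp a x)"

definition deformation_map ::
  "'a::ab_group_add conf_alg \<Rightarrow> 'a set \<Rightarrow> 'a set \<Rightarrow>
   ('a \<Rightarrow> 'a \<Rightarrow> 'a poly) \<Rightarrow> ('a \<Rightarrow> 'a \<Rightarrow> 'a poly) \<Rightarrow>
   ('a \<Rightarrow> 'a \<Rightarrow> 'a poly) \<Rightarrow> ('a \<Rightarrow> 'a \<Rightarrow> 'a poly) \<Rightarrow> ('a \<Rightarrow> 'a) \<Rightarrow> bool" where
  "deformation_map E A Q lhd rhd lharp rharp \<phi> \<longleftrightarrow>
     cmodule_hom (restrict_to E Q) (restrict_to E A) \<phi> \<and>
     (\<forall>x\<in>Q. \<forall>y\<in>Q.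
        map_poly \<phi> (lprod E x y) - lprod E (\<phi> x) (\<phi> y) =
        lharp (\<phi> x) y + rhd x (\<phi> y) - map_poly \<phi> (rharp (\<phi> x) y) - map_poly \<phi> (lhd x (\<phi> y)))"

definition deformation ::
  "'a::ab_group_add conf_alg \<Rightarrow> 'a set \<Rightarrow>
   ('a \<Rightarrow> 'a \<Rightarrow> 'a poly) \<Rightarrow> ('a \<Rightarrow> 'a \<Rightarrow> 'a poly) \<Rightarrow> ('a \<Rightarrow> 'a) \<Rightarrow> 'a conf_alg" where
  "deformation E Q lhd rharp \<phi> =
     \<lparr>carrier = Q, act = act E,
      lprod = (\<lambda>x y. lprod E x y + lhd x (\<phi> y) + rharp (\<phi> x) y)\<rparr>"

text \<open>
  An associative conformal algebra given abstractly is a complement of \<open>A\<close> in \<open>E\<close> when it is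
  identified, by an isomorphism, with a subalgebra that is a complement. With a literal equality in
  place of the isomorphism, being a complement could not be characterised up to isomorphism.
\<close>

definition is_complement_of ::
  "'b::ab_group_add conf_alg \<Rightarrow> 'a::ab_group_add set \<Rightarrow> 'a conf_alg \<Rightarrow> bool" where
  "is_complement_of B A E \<longleftrightarrow> (\<exists>Q'. complement Q' A E \<and> conf_isomorphic B (restrict_to E Q'))"

end

theory Submission
  imports Defs
begin

text \<open>
  The complements of \<open>A\<close> in \<open>E\<close> are the graphs of the deformation maps. As a \<open>\<complex>[\<partial>]\<close>-submodule, a
  complement \<open>Q'\<close> meets each coset \<open>A + x\<close> with \<open>x \<in> Q\<close> in exactly one point \<open>\<phi> x + x\<close>; this
  defines a module homomorphism \<open>\<phi> : Q \<rightarrow> A\<close> whose graph is \<open>Q'\<close>, and conversely the graph of any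
  such homomorphism is a module complement of \<open>A\<close> (\<open>complement_is_graph\<close>, \<open>graph_decomposition\<close>).

  It remains to see when a graph is closed under the \<open>\<lambda>\<close>-product. In the decomposition
  \<open>E = A \<oplus> Q\<close>, the product \<open>(\<phi> x + x)\<^sub>\<lambda> (\<phi> y + y)\<close> has the \<open>Q\<close>-component \<open>(x\<^sub>\<lambda> y)\<^sub>\<phi>\<close> and the
  \<open>A\<close>-component \<open>\<phi>(x)\<^sub>\<lambda> \<phi>(y) + \<phi>(x) \<leftharpoonup>\<^sub>\<lambda> y + x \<rhd>\<^sub>\<lambda> \<phi>(y)\<close>. It lies on the graph if and only if \<open>\<phi>\<close>
  maps the former to the latter, which is the deformation equation up to rearrangement
  (\<open>complement_graph_iff\<close>). The same computation shows that \<open>x \<mapsto> \<phi> x + x\<close> is an isomorphism from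
  \<open>Q\<^sub>\<phi>\<close> onto the graph (\<open>deformation_isomorphic_graph\<close>), so an algebra is isomorphic to a complement
  if and only if it is isomorphic to some \<open>Q\<^sub>\<phi>\<close>.
\<close>

section \<open>Coefficientwise maps and conformal isomorphisms\<close>

lemma polys_overD: "p \<in> polys_over S \<Longrightarrow> coeff p n \<in> S"
  by (simp add: polys_over_def)

lemma map_poly_add_on:
  fixes f :: "'a::ab_group_add \<Rightarrow> 'b::ab_group_add"
  assumes "f 0 = 0" and "\<And>x y. x \<in> S \<Longrightarrow> y \<in> S \<Longrightarrow> f (x + y) = f x + f y"
    and "p \<in> polys_over S" and "q \<in> polys_over S"
  shows "map_poly f (p + q) = map_poly f p + map_poly f q"
  using assms by (auto intro!: poly_eqI simp: coeff_map_poly polys_over_def)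

lemma cmodule_hom_zero:
  assumes "cmodule_hom B C f" and "0 \<in> carrier B"
  shows "f 0 = 0"
proof -
  have "f (0 + 0) = f 0 + f 0"
    using assms unfolding cmodule_hom_def by blast
  then show ?thesis by simp
qed

text \<open>
  The zero hypotheses make the maps preserve zero, without which \<open>map_poly\<close> would not act
  coefficientwise on the infinitely many vanishing coefficients.
\<close>

lemma conf_isomorphic_trans:
  assumes BC: "conf_isomorphic B C" and CD: "conf_isomorphic C D"
    and zeroB: "0 \<in> carrier B" and zeroC: "0 \<in> carrier C"
  shows "conf_isomorphic B D"
proof -
  obtain f where f: "conf_hom B C f" "bij_betw f (carrier B) (carrier C)"
    using BC unfolding conf_isomorphic_def by blast
  obtain g where g: "conf_hom C D g" "bij_betw g (carrier C) (carrier D)"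
    using CD unfolding conf_isomorphic_def by blast
  have f0: "f 0 = 0" and g0: "g 0 = 0"
    using f(1) g(1) zeroB zeroC cmodule_hom_zero unfolding conf_hom_def by blast+
  have "map_poly (g \<circ> f) p = map_poly g (map_poly f p)" for p
    using f0 g0 by (intro poly_eqI) (simp add: coeff_map_poly)
  then have "conf_hom B D (g \<circ> f)"
    using f(1) g(1) unfolding conf_hom_def cmodule_hom_def by simp
  moreover have "bij_betw (g \<circ> f) (carrier B) (carrier D)"
    using f(2) g(2) by (rule bij_betw_trans)
  ultimately show ?thesis unfolding conf_isomorphic_def by blast
qed

text \<open>
  The inverse map is under control only on the image of \<open>carrier B\<close>. The closure hypotheses ensure
  that sums, multiples and product coefficients in \<open>C\<close> are images of the corresponding elements of
  \<open>carrier B\<close>.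
\<close>

lemma conf_isomorphic_sym:
  assumes BC: "conf_isomorphic B C"
    and zero: "0 \<in> carrier B"
    and add: "\<And>x y. x \<in> carrier B \<Longrightarrow> y \<in> carrier B \<Longrightarrow> x + y \<in> carrier B"
    and act: "\<And>p x. x \<in> carrier B \<Longrightarrow> act B p x \<in> carrier B"
    and lprod: "\<And>x y. x \<in> carrier B \<Longrightarrow> y \<in> carrier B \<Longrightarrow> lprod B x y \<in> polys_over (carrier B)"
  shows "conf_isomorphic C B"
proof -
  obtain f where f: "conf_hom B C f" and bij: "bij_betw f (carrier B) (carrier C)"
    using BC unfolding conf_isomorphic_def by blast
  have fmod: "cmodule_hom B C f"
    using f unfolding conf_hom_def by blast
  define g where "g = the_inv_into (carrier B) f"
  have gf: "g (f x) = x" if "x \<in> carrier B" for x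
    unfolding g_def using bij that by (simp add: bij_betw_def the_inv_into_f_f)
  have image: "carrier C = f ` carrier B"
    using bij by (simp add: bij_betw_def)
  have f0: "f 0 = 0" using fmod zero by (rule cmodule_hom_zero)
  have g0: "g 0 = 0" using gf[OF zero] f0 by simp
  have "g (f x + f y) = g (f x) + g (f y)" if "x \<in> carrier B" "y \<in> carrier B" for x y
    using fmod that add gf unfolding cmodule_hom_def by metis
  moreover have "g (act C p (f x)) = act B p (g (f x))" if "x \<in> carrier B" for p x
    using fmod that act gf unfolding cmodule_hom_def by metis
  ultimately have gmod: "cmodule_hom C B g"
    unfolding cmodule_hom_def image by (auto simp: gf)
  have "map_poly g (lprod C (f x) (f y)) = lprod B (g (f x)) (g (f y))"
    if x: "x \<in> carrier B" and y: "y \<in> carrier B" for x y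
  proof -
    have "map_poly g (lprod C (f x) (f y)) = map_poly g (map_poly f (lprod B x y))"
      using f x y unfolding conf_hom_def by simp
    also have "\<dots> = lprod B x y"
      using f0 g0 polys_overD[OF lprod[OF x y]]
      by (intro poly_eqI) (simp add: coeff_map_poly gf)
    finally show ?thesis using x y by (simp add: gf)
  qed
  then have "conf_hom C B g"
    using gmod unfolding conf_hom_def image by blast
  moreover have "bij_betw g (carrier C) (carrier B)"
    unfolding g_def using bij by (rule bij_betw_the_inv_into)
  ultimately show ?thesis unfolding conf_isomorphic_def by blast
qed

section \<open>Module complements as graphs\<close>

definition hom_graph :: "'a::ab_group_add set \<Rightarrow> ('a \<Rightarrow> 'a) \<Rightarrow> 'a set" where
  "hom_graph Q \<phi> = (\<lambda>x. \<phi> x + x) ` Q"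

locale matched_decomposition = assoc_conf_alg E for E :: "'a::ab_group_add conf_alg" +
  fixes A Q :: "'a set" and lhd rhd lharp rharp :: "'a \<Rightarrow> 'a \<Rightarrow> 'a poly"
  assumes subalgebra_A: "subalgebra A E"
    and complement_Q: "complement Q A E"
    and matched: "associated_matched_pair E A Q lhd rhd lharp rharp"
begin

abbreviation Hom_QA :: "('a \<Rightarrow> 'a) \<Rightarrow> bool" where
  "Hom_QA \<equiv> cmodule_hom (restrict_to E Q) (restrict_to E A)"

lemma subspace_A: "subspace A" and A_carrier: "A \<subseteq> carrier E"
  and subspace_Q: "subspace Q" and Q_carrier: "Q \<subseteq> carrier E"
  using subalgebra_A complement_Q unfolding complement_def subalgebra_def by auto

lemma A_Int_Q: "A \<inter> Q = {0}" and carrier_sum: "carrier E = {a + x | a x. a \<in> A \<and> x \<in> Q}"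
  using complement_Q unfolding complement_def by auto

lemma Hom_QA_closed: "Hom_QA \<phi> \<Longrightarrow> x \<in> Q \<Longrightarrow> \<phi> x \<in> A"
  and Hom_QA_add: "Hom_QA \<phi> \<Longrightarrow> x \<in> Q \<Longrightarrow> y \<in> Q \<Longrightarrow> \<phi> (x + y) = \<phi> x + \<phi> y"
  and Hom_QA_act: "Hom_QA \<phi> \<Longrightarrow> x \<in> Q \<Longrightarrow> \<phi> (act E p x) = act E p (\<phi> x)"
  by (auto simp: cmodule_hom_def restrict_to_def)

lemma Hom_QA_zero: "Hom_QA \<phi> \<Longrightarrow> \<phi> 0 = 0"
  by (rule cmodule_hom_zero) (auto simp: restrict_to_def subspace_0[OF subspace_Q])

lemma components_unique:
  assumes "a \<in> A" and "b \<in> A" and "x \<in> Q" and "y \<in> Q" and eq: "a + x = b + y"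
  shows "a = b" and "x = y"
proof -
  have diff: "a - b = y - x" using eq by (simp add: algebra_simps)
  moreover have "a - b \<in> A" "y - x \<in> Q"
    using assms subspace_diff[OF subspace_A] subspace_diff[OF subspace_Q] by auto
  ultimately have "a - b \<in> A \<inter> Q" by simp
  then have "a - b = 0" using A_Int_Q by simp
  then show "a = b" and "x = y" using diff by auto
qed

lemma add_mem_hom_graph_iff:
  assumes \<phi>: "Hom_QA \<phi>" and a: "a \<in> A" and x: "x \<in> Q"
  shows "a + x \<in> hom_graph Q \<phi> \<longleftrightarrow> a = \<phi> x"
proof
  assume "a + x \<in> hom_graph Q \<phi>"
  then obtain y where y: "y \<in> Q" "a + x = \<phi> y + y"
    unfolding hom_graph_def by blast
  then show "a = \<phi> x"
    using components_unique[OF a Hom_QA_closed[OF \<phi> y(1)] x y] by simp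
qed (use x in \<open>simp add: hom_graph_def\<close>)

text \<open>
  The graph is the image of \<open>Q\<close> under the module automorphism \<open>a + x \<mapsto> (a + \<phi> x) + x\<close> of \<open>E\<close>,
  which fixes \<open>A\<close>; so it is a module complement because \<open>Q\<close> is one.
\<close>

lemma graph_decomposition:
  assumes \<phi>: "Hom_QA \<phi>"
  shows "hom_graph Q \<phi> \<subseteq> carrier E" and "subspace (hom_graph Q \<phi>)"
    and "A \<inter> hom_graph Q \<phi> = {0}"
    and "carrier E = {a + g | a g. a \<in> A \<and> g \<in> hom_graph Q \<phi>}"
proof -
  note \<phi>A = Hom_QA_closed[OF \<phi>]
  show "hom_graph Q \<phi> \<subseteq> carrier E"
    using \<phi>A unfolding carrier_sum hom_graph_def by blast
  show sub: "subspace (hom_graph Q \<phi>)"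
  proof (rule subspaceI)
    show "0 \<in> hom_graph Q \<phi>"
      unfolding hom_graph_def using Hom_QA_zero[OF \<phi>] subspace_0[OF subspace_Q] by force
  next
    fix u v assume "u \<in> hom_graph Q \<phi>" "v \<in> hom_graph Q \<phi>"
    then obtain x y where "x \<in> Q" "y \<in> Q" "u = \<phi> x + x" "v = \<phi> y + y"
      unfolding hom_graph_def by blast
    then have "u + v = \<phi> (x + y) + (x + y)" "x + y \<in> Q"
      using Hom_QA_add[OF \<phi>] subspace_add[OF subspace_Q] by (auto simp: algebra_simps)
    then show "u + v \<in> hom_graph Q \<phi>" unfolding hom_graph_def by blast
  next
    fix p u assume "u \<in> hom_graph Q \<phi>"
    then obtain x where "x \<in> Q" "u = \<phi> x + x"
      unfolding hom_graph_def by blast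
    then have "act E p u = \<phi> (act E p x) + act E p x" "act E p x \<in> Q"
      using Hom_QA_act[OF \<phi>] subspace_scale[OF subspace_Q] by (auto simp: scale_right_distrib)
    then show "act E p u \<in> hom_graph Q \<phi>" unfolding hom_graph_def by blast
  qed
  show "A \<inter> hom_graph Q \<phi> = {0}"
  proof -
    have "a = 0" if "a \<in> A" "a \<in> hom_graph Q \<phi>" for a
      using add_mem_hom_graph_iff[OF \<phi> that(1) subspace_0[OF subspace_Q]] that(2)
        Hom_QA_zero[OF \<phi>] by simp
    then show ?thesis using subspace_0[OF sub] subspace_0[OF subspace_A] by auto
  qed
  have "a + x \<in> {a + g | a g. a \<in> A \<and> g \<in> hom_graph Q \<phi>}" if "a \<in> A" "x \<in> Q" for a x
  proof -
    have "a + x = (a - \<phi> x) + (\<phi> x + x)" by simp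
    moreover have "a - \<phi> x \<in> A" using that \<phi>A subspace_diff[OF subspace_A] by blast
    moreover have "\<phi> x + x \<in> hom_graph Q \<phi>" using that unfolding hom_graph_def by blast
    ultimately show ?thesis by blast
  qed
  moreover have "a + (\<phi> x + x) \<in> carrier E" if "a \<in> A" "x \<in> Q" for a x
  proof -
    have "a + (\<phi> x + x) = (a + \<phi> x) + x" by (simp add: add.assoc)
    then show ?thesis
      using that \<phi>A subspace_add[OF subspace_A] unfolding carrier_sum by blast
  qed
  ultimately show "carrier E = {a + g | a g. a \<in> A \<and> g \<in> hom_graph Q \<phi>}"
    unfolding carrier_sum hom_graph_def by blast
qed

text \<open>
  The homomorphism is the negative of the projection \<open>Q \<rightarrow> A\<close> along \<open>Q'\<close>: if \<open>x = a + q\<close> with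
  \<open>a \<in> A\<close> and \<open>q \<in> Q'\<close>, then \<open>-a\<close> is the only element of \<open>A\<close> that moves \<open>x\<close> into \<open>Q'\<close>.
\<close>

lemma complement_is_graph:
  assumes compl: "complement Q' A E"
  shows "\<exists>\<phi>. Hom_QA \<phi> \<and> Q' = hom_graph Q \<phi>"
proof -
  have Q': "subspace Q'" "Q' \<subseteq> carrier E" "A \<inter> Q' = {0}"
    "carrier E = {a + x | a x. a \<in> A \<and> x \<in> Q'}"
    using compl unfolding complement_def subalgebra_def by - (elim conjE; assumption)+
  have ex: "\<exists>a. a \<in> A \<and> a + x \<in> Q'" if "x \<in> Q" for x
  proof -
    have "x \<in> {a + x | a x. a \<in> A \<and> x \<in> Q'}"
      using that Q_carrier by (simp only: Q'(4)[symmetric] subsetD)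
    then obtain a q where aq: "a \<in> A" "q \<in> Q'" "x = a + q" by blast
    then have "- a + x \<in> Q'" "- a \<in> A" using subspace_neg[OF subspace_A] by auto
    then show ?thesis by blast
  qed
  have unique: "a = b" if "a \<in> A" "b \<in> A" "a + x \<in> Q'" "b + x \<in> Q'" for a b x
  proof -
    have "a - b \<in> Q'" using subspace_diff[OF Q'(1) that(3,4)] by simp
    moreover have "a - b \<in> A" using subspace_diff[OF subspace_A that(1,2)] .
    ultimately have "a - b \<in> A \<inter> Q'" by simp
    then show ?thesis using Q'(3) by simp
  qed
  define \<phi> where "\<phi> x = (SOME a. a \<in> A \<and> a + x \<in> Q')" for x
  have \<phi>: "\<phi> x \<in> A" "\<phi> x + x \<in> Q'" if "x \<in> Q" for x
    using someI_ex[OF ex[OF that]] by (auto simp: \<phi>_def)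
  have \<phi>_eq: "\<phi> x = a" if "x \<in> Q" "a \<in> A" "a + x \<in> Q'" for x a
    using unique[OF \<phi>(1)[OF that(1)] that(2) \<phi>(2)[OF that(1)] that(3)] .
  have "\<phi> (x + y) = \<phi> x + \<phi> y" if "x \<in> Q" "y \<in> Q" for x y
  proof (rule \<phi>_eq)
    have "(\<phi> x + x) + (\<phi> y + y) \<in> Q'" using that by (intro subspace_add[OF Q'(1) \<phi>(2) \<phi>(2)])
    then show "\<phi> x + \<phi> y + (x + y) \<in> Q'" by (simp add: algebra_simps)
  qed (use \<phi>(1) that in \<open>auto intro: subspace_add subspace_A subspace_Q\<close>)
  moreover have "\<phi> (act E p x) = act E p (\<phi> x)" if "x \<in> Q" for p x
  proof (rule \<phi>_eq)
    have "act E p (\<phi> x + x) \<in> Q'" using that by (intro subspace_scale[OF Q'(1) \<phi>(2)])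
    then show "act E p (\<phi> x) + act E p x \<in> Q'" by (simp add: scale_right_distrib)
  qed (use \<phi>(1) that in \<open>auto intro: subspace_scale subspace_A subspace_Q\<close>)
  ultimately have "Hom_QA \<phi>"
    using \<phi> by (simp add: cmodule_hom_def restrict_to_def)
  moreover have "q \<in> hom_graph Q \<phi>" if "q \<in> Q'" for q
  proof -
    have "q \<in> {a + x | a x. a \<in> A \<and> x \<in> Q}"
      using that Q'(2) by (simp only: carrier_sum[symmetric] subsetD)
    then obtain a x where "a \<in> A" "x \<in> Q" "q = a + x" by blast
    with that \<phi>_eq[of x a] show ?thesis by (auto simp: hom_graph_def)
  qed
  ultimately have "Hom_QA \<phi>" and "Q' = hom_graph Q \<phi>"
    using \<phi>(2) by (auto simp: hom_graph_def)
  then show ?thesis by blast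
qed

section \<open>Products on a graph and the deformation equation\<close>

text \<open>
  This is where the deformed product comes from: it is the \<open>Q\<close>-component of a product of two graph
  elements, and the bracketed summand is the \<open>A\<close>-component.
\<close>

lemma lprod_graph:
  assumes \<phi>: "Hom_QA \<phi>" and x: "x \<in> Q" and y: "y \<in> Q"
  shows "lprod E (\<phi> x + x) (\<phi> y + y) =
      (lprod E (\<phi> x) (\<phi> y) + lharp (\<phi> x) y + rhd x (\<phi> y)) + lprod (deformation E Q lhd rharp \<phi>) x y"
proof -
  have A: "\<phi> x \<in> A" "\<phi> y \<in> A" using Hom_QA_closed[OF \<phi>] x y by auto
  then have E: "\<phi> x \<in> carrier E" "\<phi> y \<in> carrier E" "x \<in> carrier E" "y \<in> carrier E"
    using x y A_carrier Q_carrier by auto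
  have sum: "\<phi> y + y \<in> carrier E"
    using E subspace_add[OF carrier_submodule] by blast
  have "lprod E x (\<phi> y) = rhd x (\<phi> y) + lhd x (\<phi> y)"
    "lprod E (\<phi> x) y = lharp (\<phi> x) y + rharp (\<phi> x) y"
    using matched A x y unfolding associated_matched_pair_def by blast+
  then show ?thesis
    using E sum by (simp add: lprod_add_left lprod_add_right deformation_def algebra_simps)
qed

lemma lprod_graph_A_component:
  assumes \<phi>: "Hom_QA \<phi>" and x: "x \<in> Q" and y: "y \<in> Q"
  shows "lprod E (\<phi> x) (\<phi> y) + lharp (\<phi> x) y + rhd x (\<phi> y) \<in> polys_over A"
proof -
  have A: "\<phi> x \<in> A" "\<phi> y \<in> A" using Hom_QA_closed[OF \<phi>] x y by auto
  then have "lprod E (\<phi> x) (\<phi> y) \<in> polys_over A" "lharp (\<phi> x) y \<in> polys_over A"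
    "rhd x (\<phi> y) \<in> polys_over A"
    using subalgebra_A matched x y unfolding subalgebra_def associated_matched_pair_def by blast+
  then show ?thesis by (simp add: polys_over_def subspace_add[OF subspace_A])
qed

lemma deformation_lprod_summands_closed:
  assumes \<phi>: "Hom_QA \<phi>" and x: "x \<in> Q" and y: "y \<in> Q"
  shows "lprod E x y \<in> polys_over Q" and "lhd x (\<phi> y) \<in> polys_over Q"
    and "rharp (\<phi> x) y \<in> polys_over Q"
  using Hom_QA_closed[OF \<phi>] complement_Q matched x y
  unfolding complement_def subalgebra_def associated_matched_pair_def by blast+

lemma deformation_lprod_closed:
  assumes "Hom_QA \<phi>" and "x \<in> Q" and "y \<in> Q"
  shows "lprod (deformation E Q lhd rharp \<phi>) x y \<in> polys_over Q"
  using deformation_lprod_summands_closed[OF assms]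
  by (simp add: deformation_def polys_over_def subspace_add[OF subspace_Q])

text \<open>
  By additivity of \<open>\<phi>\<close>, its three values in the deformation equation combine into its value on the
  deformed product.
\<close>

lemma deformation_map_iff:
  "deformation_map E A Q lhd rhd lharp rharp \<phi> \<longleftrightarrow> Hom_QA \<phi> \<and>
     (\<forall>x\<in>Q. \<forall>y\<in>Q. map_poly \<phi> (lprod (deformation E Q lhd rharp \<phi>) x y) =
        lprod E (\<phi> x) (\<phi> y) + lharp (\<phi> x) y + rhd x (\<phi> y))"
proof -
  have "map_poly \<phi> (lprod (deformation E Q lhd rharp \<phi>) x y) =
      map_poly \<phi> (lprod E x y) + map_poly \<phi> (lhd x (\<phi> y)) + map_poly \<phi> (rharp (\<phi> x) y)"
    if \<phi>: "Hom_QA \<phi>" and xy: "x \<in> Q" "y \<in> Q" for x y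
  proof -
    note closed = deformation_lprod_summands_closed[OF \<phi> xy]
    have "lprod E x y + lhd x (\<phi> y) \<in> polys_over Q"
      using closed by (simp add: polys_over_def subspace_add[OF subspace_Q])
    then show ?thesis
      using closed map_poly_add_on[where f = \<phi> and S = Q] Hom_QA_zero[OF \<phi>] Hom_QA_add[OF \<phi>]
      by (simp add: deformation_def)
  qed
  then show ?thesis
    unfolding deformation_map_def by (auto simp: algebra_simps)
qed

text \<open>
  A product of two graph elements lies on the graph if and only if, coefficient by coefficient, its
  \<open>A\<close>-component is the image under \<open>\<phi>\<close> of its \<open>Q\<close>-component.
\<close>

lemma complement_graph_iff:
  assumes \<phi>: "Hom_QA \<phi>"
  shows "complement (hom_graph Q \<phi>) A E \<longleftrightarrow> deformation_map E A Q lhd rhd lharp rharp \<phi>"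
proof -
  have product: "lprod E (\<phi> x + x) (\<phi> y + y) \<in> polys_over (hom_graph Q \<phi>) \<longleftrightarrow>
      map_poly \<phi> (lprod (deformation E Q lhd rharp \<phi>) x y) =
        lprod E (\<phi> x) (\<phi> y) + lharp (\<phi> x) y + rhd x (\<phi> y)"
    (is "_ \<longleftrightarrow> map_poly \<phi> ?q = ?p") if x: "x \<in> Q" and y: "y \<in> Q" for x y
  proof -
    have "coeff ?p n + coeff ?q n \<in> hom_graph Q \<phi> \<longleftrightarrow> coeff ?p n = \<phi> (coeff ?q n)" for n
      by (intro add_mem_hom_graph_iff[OF \<phi>] polys_overD lprod_graph_A_component[OF \<phi> x y]
          deformation_lprod_closed[OF \<phi> x y])
    then have "?p + ?q \<in> polys_over (hom_graph Q \<phi>) \<longleftrightarrow> (\<forall>n. coeff ?p n = \<phi> (coeff ?q n))"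
      by (simp only: polys_over_def mem_Collect_eq coeff_add[symmetric])
    also have "\<dots> \<longleftrightarrow> map_poly \<phi> ?q = ?p"
      by (auto simp: poly_eq_iff coeff_map_poly Hom_QA_zero[OF \<phi>])
    finally show ?thesis by (simp only: lprod_graph[OF \<phi> x y])
  qed
  have "complement (hom_graph Q \<phi>) A E \<longleftrightarrow>
      (\<forall>u\<in>hom_graph Q \<phi>. \<forall>v\<in>hom_graph Q \<phi>. lprod E u v \<in> polys_over (hom_graph Q \<phi>))"
    using graph_decomposition[OF \<phi>] unfolding complement_def subalgebra_def by blast
  also have "\<dots> \<longleftrightarrow> (\<forall>x\<in>Q. \<forall>y\<in>Q. lprod E (\<phi> x + x) (\<phi> y + y) \<in> polys_over (hom_graph Q \<phi>))"
    by (simp add: hom_graph_def)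
  also have "\<dots> \<longleftrightarrow> deformation_map E A Q lhd rhd lharp rharp \<phi>"
    using \<phi> product by (simp add: deformation_map_iff)
  finally show ?thesis .
qed

text \<open>
  The deformation equation makes \<open>\<phi>((x\<^sub>\<lambda> y)\<^sub>\<phi>)\<close> equal to the \<open>A\<close>-component in \<open>lprod_graph\<close>, so
  \<open>x \<mapsto> \<phi> x + x\<close> is multiplicative.
\<close>

lemma deformation_isomorphic_graph:
  assumes deform: "deformation_map E A Q lhd rhd lharp rharp \<phi>"
  shows "conf_isomorphic (deformation E Q lhd rharp \<phi>) (restrict_to E (hom_graph Q \<phi>))"
proof -
  have \<phi>: "Hom_QA \<phi>" using deform by (simp add: deformation_map_def)
  let ?D = "deformation E Q lhd rharp \<phi>" and ?G = "restrict_to E (hom_graph Q \<phi>)"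
  let ?\<iota> = "\<lambda>x. \<phi> x + x"
  have carriers: "carrier ?D = Q" "carrier ?G = hom_graph Q \<phi>"
    "act ?D = act E" "act ?G = act E" "lprod ?G = lprod E"
    by (simp_all add: deformation_def restrict_to_def)
  have "cmodule_hom ?D ?G ?\<iota>"
    unfolding cmodule_hom_def carriers
    using Hom_QA_add[OF \<phi>] Hom_QA_act[OF \<phi>]
    by (auto simp: hom_graph_def scale_right_distrib algebra_simps)
  moreover have "map_poly ?\<iota> (lprod ?D x y) = lprod E (?\<iota> x) (?\<iota> y)" if "x \<in> Q" "y \<in> Q" for x y
  proof -
    have "map_poly ?\<iota> (lprod ?D x y) = map_poly \<phi> (lprod ?D x y) + lprod ?D x y"
      by (intro poly_eqI) (simp add: coeff_map_poly Hom_QA_zero[OF \<phi>])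
    then show ?thesis
      using deform that by (simp add: deformation_map_iff lprod_graph[OF \<phi>])
  qed
  moreover have "inj_on ?\<iota> Q"
    using components_unique(2) Hom_QA_closed[OF \<phi>] by (intro inj_onI) metis
  then have "bij_betw ?\<iota> (carrier ?D) (carrier ?G)"
    unfolding carriers by (simp add: bij_betw_def hom_graph_def)
  ultimately show ?thesis
    unfolding conf_isomorphic_def conf_hom_def carriers by blast
qed

lemma graph_isomorphic_deformation:
  assumes deform: "deformation_map E A Q lhd rhd lharp rharp \<phi>"
  shows "conf_isomorphic (restrict_to E (hom_graph Q \<phi>)) (deformation E Q lhd rharp \<phi>)"
proof (rule conf_isomorphic_sym[OF deformation_isomorphic_graph[OF deform]])
  have \<phi>: "Hom_QA \<phi>" using deform by (simp add: deformation_map_def)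
  fix x y assume "x \<in> carrier (deformation E Q lhd rharp \<phi>)"
    and "y \<in> carrier (deformation E Q lhd rharp \<phi>)"
  then show "lprod (deformation E Q lhd rharp \<phi>) x y
      \<in> polys_over (carrier (deformation E Q lhd rharp \<phi>))"
    using deformation_lprod_closed[OF \<phi>] by (simp add: deformation_def)
qed (use subspace_Q in \<open>simp_all add: deformation_def subspace_0 subspace_add subspace_scale\<close>)

end

section \<open>Classification of complements\<close>

theorem theorem4p7:
  fixes E :: "'a::ab_group_add conf_alg"
    and A Q :: "'a set"
    and lhd rhd lharp rharp :: "'a \<Rightarrow> 'a \<Rightarrow> 'a poly"
    and Qbar :: "'b::ab_group_add conf_alg"
  assumes "assoc_conf_alg E"
    and "subalgebra A E"
    and "complement Q A E"
    and "associated_matched_pair E A Q lhd rhd lharp rharp"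
    and "assoc_conf_alg Qbar"
  shows "is_complement_of Qbar A E \<longleftrightarrow>
    (\<exists>\<phi>. deformation_map E A Q lhd rhd lharp rharp \<phi> \<and>
         conf_isomorphic Qbar (deformation E Q lhd rharp \<phi>))"
proof -
  interpret matched_decomposition E A Q lhd rhd lharp rharp
    using assms(1-4) by (simp add: matched_decomposition_def matched_decomposition_axioms_def)
  interpret Qbar: assoc_conf_alg Qbar by (rule assms(5))
  have zero: "0 \<in> carrier Qbar"
    using Qbar.carrier_submodule by (rule Qbar.subspace_0)
  show ?thesis
  proof
    assume "is_complement_of Qbar A E"
    then obtain Q' where compl: "complement Q' A E"
      and iso: "conf_isomorphic Qbar (restrict_to E Q')"
      unfolding is_complement_of_def by blast
    obtain \<phi> where \<phi>: "Hom_QA \<phi>" and Q': "Q' = hom_graph Q \<phi>"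
      using complement_is_graph[OF compl] by blast
    have deform: "deformation_map E A Q lhd rhd lharp rharp \<phi>"
      using compl complement_graph_iff[OF \<phi>] Q' by simp
    have "0 \<in> carrier (restrict_to E Q')"
      using subspace_0[OF graph_decomposition(2)[OF \<phi>]] Q' by (simp add: restrict_to_def)
    then have "conf_isomorphic Qbar (deformation E Q lhd rharp \<phi>)"
      using conf_isomorphic_trans iso graph_isomorphic_deformation[OF deform] zero Q' by blast
    with deform show "\<exists>\<phi>. deformation_map E A Q lhd rhd lharp rharp \<phi> \<and>
        conf_isomorphic Qbar (deformation E Q lhd rharp \<phi>)" by blast
  next
    assume "\<exists>\<phi>. deformation_map E A Q lhd rhd lharp rharp \<phi> \<and>
        conf_isomorphic Qbar (deformation E Q lhd rharp \<phi>)"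
    then obtain \<phi> where deform: "deformation_map E A Q lhd rhd lharp rharp \<phi>"
      and iso: "conf_isomorphic Qbar (deformation E Q lhd rharp \<phi>)" by blast
    have "0 \<in> carrier (deformation E Q lhd rharp \<phi>)"
      using subspace_0[OF subspace_Q] by (simp add: deformation_def)
    then have "conf_isomorphic Qbar (restrict_to E (hom_graph Q \<phi>))"
      using conf_isomorphic_trans iso deformation_isomorphic_graph[OF deform] zero by blast
    moreover have "complement (hom_graph Q \<phi>) A E"
      using deform complement_graph_iff deformation_map_iff by blast
    ultimately show "is_complement_of Qbar A E"
      unfolding is_complement_of_def by blast
  qed
qed

end
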